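(* Let $m<n$ be positive integers and let $D\subsetneq\mathbb{C}^m$ and $\Omega\subsetneq\mathbb{C}^n$ be bounded strongly pseudoconvex domains. Let $F=(F_1,\dots,F_n):D\to\Omega$ be a proper holomorphic map, and assume that there exists some $p>m$ such that $$\frac{\partial F_\mu}{\partial z_j}\,\overline{\frac{\partial F_\nu}{\partial z_k}}\in\mathbb{L}^p(D,\mathsf{m}_{2m})$$ for all $j,k$ with $1\leq j,k\leq m$ and all $\mu,\nu$ with $1\leq\mu,\nu\leq n$. Then $F$ extends to a continuous map $\widetilde F:\overline D\to\overline\Omega$ with $\widetilde F(\partial D)\subseteq\partial\Omega$.
   Context: $\mathsf{m}_{2m}$ denotes the $2m$-dimensional Lebesgue measure on $\mathbb{C}^m\cong\mathbb{R}^{2m}$. A bounded strongly pseudoconvex domain is a bounded domain with $\mathcal{C}^2$-smooth boundary whose Levi form is positive definite at every boundary point; equivalently, it has a $\mathcal{C}^2$-smooth strongly plurisubharmonic defining function. *)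

theory Defs
  imports "HOL-Analysis.Analysis"
begin

text \<open>
  Complex Euclidean space is \<^typ>\<open>complex ^ 'm\<close>. As a real Euclidean space it has dimension
  \<open>2 * CARD('m)\<close>, and \<^term>\<open>lebesgue\<close> on it is the corresponding Lebesgue measure.
\<close>

definition domain :: "(complex ^ 'm) set \<Rightarrow> bool" where
  "domain D \<longleftrightarrow> open D \<and> connected D \<and> D \<noteq> {}"

text \<open>Holomorphy in several variables on an open set: the real Frechet derivative exists at each
  point and is complex linear.\<close>

definition holomorphic_map_on :: "(complex ^ 'm \<Rightarrow> complex ^ 'n) \<Rightarrow> (complex ^ 'm) set \<Rightarrow> bool" where
  "holomorphic_map_on F D \<longleftrightarrow>
     (\<forall>z\<in>D. \<exists>F'. (F has_derivative F') (at z) \<and> (\<forall>c v. F' (c *s v) = c *s F' v))"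

definition dir_deriv :: "(complex ^ 'm \<Rightarrow> complex) \<Rightarrow> complex ^ 'm \<Rightarrow> complex ^ 'm \<Rightarrow> complex" where
  "dir_deriv f v z = vector_derivative (\<lambda>t::real. f (z + t *\<^sub>R v)) (at 0)"

text \<open>The Wirtinger operators
  \<open>\<partial>/\<partial>z\<^sub>j = (\<partial>/\<partial>x\<^sub>j - i \<partial>/\<partial>y\<^sub>j) / 2\<close> and its conjugate. On holomorphic functions, \<open>dz j\<close> is the complex
  partial derivative.\<close>

definition dz :: "'m \<Rightarrow> (complex ^ 'm \<Rightarrow> complex) \<Rightarrow> complex ^ 'm \<Rightarrow> complex" where
  "dz j f z = (dir_deriv f (axis j 1) z - \<i> * dir_deriv f (axis j \<i>) z) / 2"

definition dzbar :: "'m \<Rightarrow> (complex ^ 'm \<Rightarrow> complex) \<Rightarrow> complex ^ 'm \<Rightarrow> complex" where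
  "dzbar j f z = (dir_deriv f (axis j 1) z + \<i> * dir_deriv f (axis j \<i>) z) / 2"

text \<open>Class \<open>C\<^sup>2\<close> on an open set, with the derivatives taken in the operator norm.\<close>

definition C2_on :: "('a::real_normed_vector \<Rightarrow> real) \<Rightarrow> 'a set \<Rightarrow> bool" where
  "C2_on r U \<longleftrightarrow>
     (\<exists>(r' :: 'a \<Rightarrow> 'a \<Rightarrow>\<^sub>L real) (r'' :: 'a \<Rightarrow> 'a \<Rightarrow>\<^sub>L 'a \<Rightarrow>\<^sub>L real).
        (\<forall>x\<in>U. (r has_derivative blinfun_apply (r' x)) (at x)) \<and>
        (\<forall>x\<in>U. (r' has_derivative blinfun_apply (r'' x)) (at x)) \<and>
        continuous_on U r'')"

text \<open>Since \<open>dr\<close> does not vanish on \<open>U\<close>, the last conjunct makes \<open>frontier D \<inter> U\<close> the zero set of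
  \<open>r\<close> in \<open>U\<close>.\<close>

definition local_defining_function ::
    "(complex ^ 'm) set \<Rightarrow> complex ^ 'm \<Rightarrow> (complex ^ 'm) set \<Rightarrow> (complex ^ 'm \<Rightarrow> real) \<Rightarrow> bool" where
  "local_defining_function D \<zeta> U r \<longleftrightarrow>
     open U \<and> \<zeta> \<in> U \<and> C2_on r U \<and>
     (\<forall>z\<in>U. frechet_derivative r (at z) \<noteq> (\<lambda>v. 0)) \<and>
     D \<inter> U = {z\<in>U. r z < 0}"

definition levi_form :: "(complex ^ 'm \<Rightarrow> real) \<Rightarrow> complex ^ 'm \<Rightarrow> complex ^ 'm \<Rightarrow> complex" where
  "levi_form r \<zeta> v =
     (\<Sum>j\<in>UNIV. \<Sum>k\<in>UNIV.
        dz j (dzbar k (\<lambda>z. complex_of_real (r z))) \<zeta> * v $ j * cnj (v $ k))"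

definition complex_tangent_space :: "(complex ^ 'm \<Rightarrow> real) \<Rightarrow> complex ^ 'm \<Rightarrow> (complex ^ 'm) set" where
  "complex_tangent_space r \<zeta> =
     {v. (\<Sum>j\<in>UNIV. dz j (\<lambda>z. complex_of_real (r z)) \<zeta> * v $ j) = 0}"

text \<open>The Levi form of a \<open>C\<^sup>2\<close> function is real valued. On the complex tangent space another local
  defining function only changes it by a positive factor, so one such function at each boundary
  point suffices.\<close>

definition strongly_pseudoconvex :: "(complex ^ 'm) set \<Rightarrow> bool" where
  "strongly_pseudoconvex D \<longleftrightarrow>
     (\<forall>\<zeta>\<in>frontier D. \<exists>U r. local_defining_function D \<zeta> U r \<and>
        (\<forall>v\<in>complex_tangent_space r \<zeta>. v \<noteq> 0 \<longrightarrow> 0 < Re (levi_form r \<zeta> v)))"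

definition bounded_strongly_pseudoconvex_domain :: "(complex ^ 'm) set \<Rightarrow> bool" where
  "bounded_strongly_pseudoconvex_domain D \<longleftrightarrow>
     domain D \<and> bounded D \<and> strongly_pseudoconvex D"

definition in_Lp :: "real \<Rightarrow> 'a::euclidean_space set \<Rightarrow> ('a \<Rightarrow> complex) \<Rightarrow> bool" where
  "in_Lp p D g \<longleftrightarrow>
     g \<in> borel_measurable (lebesgue_on D) \<and>
     integrable (lebesgue_on D) (\<lambda>z. cmod (g z) powr p)"

end

(*
  Since 2p exceeds the real dimension 2m of D, the map has a Hoelder modulus of continuity near the
  boundary. Concretely, the sub-mean value property of a holomorphic derivative g with |g|^(2p)
  integrable gives |g(z)| <= C dist(z, bD)^(-m/p) with m/p < 1. A C^1 boundary satisfies a uniform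
  interior cone condition, and the blow-up rate is integrable along the axis of the cone, so F has a
  limit at every boundary point. Properness forces the limits into the boundary of the target.
*)
theory Submission
  imports Defs "HOL-Complex_Analysis.Complex_Analysis"
begin

text \<open>A diagonal product \<open>dz j f z * cnj (dz j f z)\<close> has modulus
  \<open>cmod (dz j f z)\<close> squared, so its membership in L^p puts the derivative in L^(2p)
  over a space of real dimension 2m. Averaging over a ball of radius \<delta> then costs
  \<delta>^(-2m/(2p)), which is the exponent m/p.

  Holomorphy here means pointwise complex differentiability, so at the outset nothing is known about
  how the derivative varies with the point. Its regularity is recovered on complex lines
  \<open>a + c *s w\<close>, where one-variable theory applies. Rotating such lines about the centre
  turns circle means into ball means, because multiplication by e^(it) preserves Lebesgue measure.
  The mean is taken of |g| itself; an elementary inequality replaces Hoelder or the subharmonicity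
  of |g|^(2p).

  Near a boundary point \<zeta> all cones share one axis direction e. Points x and y near \<zeta>
  are compared through x + t e and y + t e, which for fixed t are close to one interior point, so no
  path inside D from x to y has to be built.\<close>

section \<open>The sub-mean value property on balls\<close>

lemma norm_vector_smult_complex: "norm (c *s v) = cmod c * norm (v :: complex ^ 'm)"
  by (simp add: norm_vec_def norm_mult L2_set_right_distrib)

lemma bounded_linear_vector_smult_left: "bounded_linear (\<lambda>c::complex. c *s (v :: complex ^ 'm))"
  by (rule bounded_linear_intro[where K = "norm v"])
     (auto simp: vec_eq_iff norm_vector_smult_complex algebra_simps)

lemma linear_vector_smult_right: "linear (\<lambda>v :: complex ^ 'm. (c::complex) *s v)"
  by (rule linearI) (auto simp: vec_eq_iff algebra_simps)

lemma continuous_on_vector_smult [continuous_intros]: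
  fixes f :: "'a::topological_space \<Rightarrow> complex" and g :: "'a \<Rightarrow> complex ^ 'm"
  assumes "continuous_on S f" "continuous_on S g"
  shows "continuous_on S (\<lambda>x. f x *s g x)"
  unfolding vector_scalar_mult_def
  by (intro continuous_intros assms)

section \<open>Invariance of Lebesgue measure under translations and linear isometries\<close>

lemma nn_integral_lborel_translation:
  fixes f :: "'a::euclidean_space \<Rightarrow> ennreal"
  assumes [measurable]: "f \<in> borel_measurable borel"
  shows "(\<integral>\<^sup>+x. f (a + x) \<partial>lborel) = (\<integral>\<^sup>+x. f x \<partial>lborel)"
proof -
  have "(\<integral>\<^sup>+x. f x \<partial>lborel) = (\<integral>\<^sup>+x. f x \<partial>distr lborel borel ((+) a))"
    by (simp add: lborel_distr_plus)
  also have "\<dots> = (\<integral>\<^sup>+x. f (a + x) \<partial>lborel)"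
    by (simp add: nn_integral_distr)
  finally show ?thesis ..
qed

text \<open>Uniqueness of translation invariant measures, by computing one double integral in both orders;
  the normalisation is read off the unit ball, which an isometry preserves.\<close>

lemma lborel_distr_linear_isometry:
  fixes T :: "'a::euclidean_space \<Rightarrow> 'a"
  assumes lin: "linear T" and iso: "\<And>x. norm (T x) = norm x"
  shows "distr lborel borel T = lborel"
proof (rule measure_eqI)
  have [measurable]: "T \<in> borel_measurable borel"
    using lin linear_continuous_on linear_conv_bounded_linear
    by (intro borel_measurable_continuous_onI) blast
  have inj: "inj T"
    using linear_injective_0[OF lin] iso by (metis norm_eq_zero)
  have surj: "surj T"
    using lin inj by (rule eucl.linear_inj_imp_surj)
  fix A assume "A \<in> sets (distr lborel borel T)"
  then have [measurable]: "A \<in> sets borel"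
    by simp
  let ?i = "\<lambda>S x. indicator S x :: ennreal"
  let ?B = "ball (0::'a) 1"
  have [measurable]: "?B \<in> sets borel"
    by simp
  have left: "(\<integral>\<^sup>+x. ?i A (T x + y) \<partial>lborel) = emeasure (distr lborel borel T) A" for y
  proof -
    obtain u where y: "y = T u"
      using surj by blast
    have "(\<integral>\<^sup>+x. ?i A (T x + y) \<partial>lborel) = (\<integral>\<^sup>+x. ?i A (T (u + x)) \<partial>lborel)"
      by (simp add: y linear_add[OF lin] add.commute)
    also have "\<dots> = (\<integral>\<^sup>+x. ?i A (T x) \<partial>lborel)"
      by (rule nn_integral_lborel_translation) measurable
    also have "\<dots> = (\<integral>\<^sup>+x. ?i A x \<partial>distr lborel borel T)"
      by (rule nn_integral_distr[symmetric]) measurable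
    finally show ?thesis
      by simp
  qed
  have right: "(\<integral>\<^sup>+x. ?i ?B (y - T x) \<partial>lborel) = emeasure lborel ?B" for y
  proof -
    obtain u where y: "y = T u"
      using surj by blast
    have "?i ?B (y - T x) = ?i (ball u 1) x" for x
    proof -
      have "norm (y - T x) = norm (u - x)"
        using iso[of "u - x"] by (simp add: y linear_diff[OF lin])
      then show ?thesis
        by (simp add: indicator_def dist_norm norm_minus_commute)
    qed
    then show ?thesis
      by (simp add: emeasure_ball)
  qed
  \<comment> \<open>Integrating in \<open>x\<close> first gives this product by \<open>left\<close>.
    In the other order, the shift by \<open>T x\<close> in \<open>y\<close> moves the dependence on
    \<open>x\<close> from \<open>A\<close> into the ball, where \<open>right\<close> removes it. The
    volume of \<open>?B\<close> is positive and finite and cancels.\<close>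
  have "emeasure (distr lborel borel T) A * emeasure lborel ?B
      = (\<integral>\<^sup>+y. (\<integral>\<^sup>+x. ?i A (T x + y) * ?i ?B y \<partial>lborel) \<partial>lborel)"
    by (simp add: nn_integral_multc nn_integral_cmult_indicator left)
  also have "\<dots> = (\<integral>\<^sup>+x. (\<integral>\<^sup>+y. ?i A (T x + y) * ?i ?B y \<partial>lborel) \<partial>lborel)"
    by (rule lborel_pair.Fubini') measurable
  also have "\<dots> = (\<integral>\<^sup>+x. (\<integral>\<^sup>+y. ?i A y * ?i ?B (y - T x) \<partial>lborel) \<partial>lborel)"
    by (subst nn_integral_lborel_translation[symmetric, of "\<lambda>y. ?i A y * ?i ?B (y - T x)" "T x" for x])
       auto
  also have "\<dots> = (\<integral>\<^sup>+y. (\<integral>\<^sup>+x. ?i A y * ?i ?B (y - T x) \<partial>lborel) \<partial>lborel)"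
    by (rule lborel_pair.Fubini') measurable
  also have "\<dots> = emeasure lborel A * emeasure lborel ?B"
    by (simp add: nn_integral_multc nn_integral_cmult right)
  finally show "emeasure (distr lborel borel T) A = emeasure lborel A"
    using less_imp_neq[OF unit_ball_vol_pos[of "real DIM('a)", OF of_nat_0_le_iff]]
    by (simp add: emeasure_ball mult.commute[of _ "ennreal (unit_ball_vol (real DIM('a)))"]
        ennreal_mult_cancel_left)
qed simp

text \<open>Cauchy's formula at the centre: on the unit circle du/u = 2 pi i dt, so
  \<open>h 0\<close> is the mean of \<open>h\<close>. The bound is stated in \<open>ennreal\<close>
  so that it can later be integrated over a family of circles without an integrability
  condition.\<close>

lemma circle_mean_value_bound:
  assumes "continuous_on (cball 0 1) h" "h holomorphic_on ball 0 1"
  shows "ennreal (cmod (h 0)) \<le> (\<integral>\<^sup>+t\<in>{0..1}. ennreal (cmod (h (cis (2 * pi * t)))) \<partial>lborel)"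
proof -
  have "((\<lambda>u. h u / (u - 0)) has_contour_integral (2 * of_real pi * \<i> * h 0)) (circlepath 0 1)"
    using assms by (intro Cauchy_integral_circlepath) auto
  then have "((\<lambda>t. h (cis (2 * pi * t)) * (2 * of_real pi * \<i>)) has_integral
      (2 * of_real pi * \<i> * h 0)) {0..1}"
    unfolding has_contour_integral_def
  proof (rule has_integral_eq[rotated])
    fix t :: real assume t: "t \<in> {0..1}"
    have c: "circlepath 0 1 t = cis (2 * pi * t)"
      by (simp add: circlepath cis_conv_exp mult_ac)
    have "vector_derivative (circlepath 0 1) (at t within {0..1})
        = 2 * of_real pi * \<i> * cis (2 * pi * t)"
      using t by (simp add: vector_derivative_circlepath01 cis_conv_exp mult_ac)
    then show "h (circlepath 0 1 t) / (circlepath 0 1 t - 0)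
        * vector_derivative (circlepath 0 1) (at t within {0..1})
        = h (cis (2 * pi * t)) * (2 * of_real pi * \<i>)"
      by (simp add: c)
  qed
  from has_integral_mult_left[OF this, of "1 / (2 * of_real pi * \<i>)"]
  have hi: "((\<lambda>t. h (cis (2 * pi * t))) has_integral h 0) {0..1}"
    by simp
  have "continuous_on {0..1::real} (\<lambda>t. h (cis (2 * pi * t)))"
    by (rule continuous_on_compose2[OF assms(1)]) (auto intro!: continuous_intros)
  then have si: "set_integrable lborel {0..1} (\<lambda>t::real. h (cis (2 * pi * t)))"
    by (rule borel_integrable_atLeastAtMost')
  have "h 0 = (LBINT t:{0..1}. h (cis (2 * pi * t)))"
    using set_borel_integral_eq_integral(2)[OF si] integral_unique[OF hi] by simp
  also have "ennreal (cmod \<dots>) \<le> (\<integral>\<^sup>+t. norm (indicator {0..1} t *\<^sub>R h (cis (2 * pi * t))) \<partial>lborel)"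
    using si unfolding set_integrable_def set_lebesgue_integral_def
    by (rule integral_norm_bound_ennreal)
  also have "\<dots> = (\<integral>\<^sup>+t\<in>{0..1}. ennreal (cmod (h (cis (2 * pi * t)))) \<partial>lborel)"
    by (intro nn_integral_cong) (auto simp: indicator_def)
  finally show ?thesis .
qed

text \<open>Each \<open>w\<close> in the ball gives a circle through \<open>z + w\<close> about
  \<open>z\<close> in a complex line, on which the one-variable bound holds. Integrating over
  \<open>w\<close> and exchanging the integrals leaves, for each angle, a rotated copy of the same
  ball integral. Hence holomorphy along lines through \<open>z\<close> suffices.\<close>

lemma sub_mean_value_ball:
  fixes g :: "complex ^ 'm \<Rightarrow> complex"
  assumes meas: "(\<lambda>x. indicator (ball z \<delta>) x * g x) \<in> borel_measurable borel"
    and hol: "\<And>w. w \<in> ball 0 \<delta> \<Longrightarrow>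
      \<exists>S. open S \<and> cball 0 1 \<subseteq> S \<and> (\<lambda>c. g (z + c *s w)) holomorphic_on S"
  shows "ennreal (cmod (g z)) * emeasure lborel (ball z \<delta>)
     \<le> (\<integral>\<^sup>+x\<in>ball z \<delta>. ennreal (cmod (g x)) \<partial>lborel)"
proof -
  \<comment> \<open>Cutting off to the ball makes \<open>G\<close> globally measurable although
    \<open>g\<close> is arbitrary outside, and the cutoff is itself invariant under
    rotations.\<close>
  define G where "G x = ennreal (cmod (indicator (ball z \<delta>) (z + x) * g (z + x)))" for x
  have [measurable]: "G \<in> borel_measurable borel"
  proof -
    have "(\<lambda>x. indicator (ball z \<delta>) (z + x) * g (z + x)) \<in> borel_measurable borel"
      by (rule measurable_compose[OF _ meas]) auto
    then show ?thesis
      unfolding G_def by measurable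
  qed
  have Gball: "G x = (if norm x < \<delta> then ennreal (cmod (g (z + x))) else 0)" for x
    by (auto simp: G_def indicator_def dist_norm)
  have joint [measurable]: "(\<lambda>(w::complex ^ 'm, t::real). G (cis (2 * pi * t) *s w) * indicator {0..1} t)
      \<in> borel_measurable (lborel \<Otimes>\<^sub>M lborel)"
  proof -
    have "(\<lambda>p :: (complex ^ 'm) \<times> real. cis (2 * pi * snd p) *s fst p) \<in> borel_measurable borel"
      by (intro borel_measurable_continuous_onI continuous_intros)
    then have [measurable]: "(\<lambda>p :: (complex ^ 'm) \<times> real. cis (2 * pi * snd p) *s fst p)
        \<in> borel_measurable (lborel \<Otimes>\<^sub>M lborel)"
      by (simp add: lborel_prod)
    show ?thesis
      unfolding case_prod_unfold by measurable
  qed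
  have rot: "(\<integral>\<^sup>+w. G (cis (2 * pi * t) *s w) \<partial>lborel) = (\<integral>\<^sup>+w. G w \<partial>lborel)" for t
  proof -
    have "distr lborel borel (\<lambda>w::complex ^ 'm. cis (2 * pi * t) *s w) = lborel"
      by (intro lborel_distr_linear_isometry linear_vector_smult_right) (simp add: norm_vector_smult_complex)
    moreover have "(\<lambda>w::complex ^ 'm. cis (2 * pi * t) *s w) \<in> borel_measurable borel"
      by (intro borel_measurable_continuous_onI continuous_intros)
    ultimately show ?thesis
      using nn_integral_distr[of "\<lambda>w::complex ^ 'm. cis (2 * pi * t) *s w" lborel borel G] by simp
  qed
  have pointwise: "ennreal (cmod (g z)) * indicator (ball 0 \<delta>) w
      \<le> (\<integral>\<^sup>+t. G (cis (2 * pi * t) *s w) * indicator {0..1} t \<partial>lborel)" for w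
  proof (cases "w \<in> ball 0 \<delta>")
    case True
    then obtain S where S: "open S" "cball 0 1 \<subseteq> S" "(\<lambda>c. g (z + c *s w)) holomorphic_on S"
      using hol by blast
    have "ennreal (cmod (g (z + 0 *s w)))
        \<le> (\<integral>\<^sup>+t\<in>{0..1}. ennreal (cmod (g (z + cis (2 * pi * t) *s w))) \<partial>lborel)"
      using S ball_subset_cball
      by (intro circle_mean_value_bound) (blast intro: holomorphic_on_imp_continuous_on holomorphic_on_subset)+
    moreover have "z + 0 *s w = z"
      by simp
    ultimately show ?thesis
      using True by (simp add: Gball norm_vector_smult_complex)
  qed auto
  have "ennreal (cmod (g z)) * emeasure lborel (ball z \<delta>)
      = (\<integral>\<^sup>+w. ennreal (cmod (g z)) * indicator (ball 0 \<delta>) (w :: complex ^ 'm) \<partial>lborel)"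
    by (cases "0 \<le> \<delta>") (simp_all add: ball_empty nn_integral_cmult_indicator emeasure_ball)
  also have "\<dots> \<le> (\<integral>\<^sup>+w. \<integral>\<^sup>+t. G (cis (2 * pi * t) *s w) * indicator {0..1} t \<partial>lborel \<partial>lborel)"
    by (intro nn_integral_mono pointwise)
  also have "\<dots> = (\<integral>\<^sup>+t. \<integral>\<^sup>+w. G (cis (2 * pi * t) *s w) * indicator {0..1} t \<partial>lborel \<partial>lborel)"
    by (rule lborel_pair.Fubini'[symmetric]) (rule joint)
  also have "\<dots> = (\<integral>\<^sup>+t. (\<integral>\<^sup>+w. G w \<partial>lborel) * indicator {0..1::real} t \<partial>lborel)"
  proof (intro nn_integral_cong)
    fix t :: real
    have "(\<lambda>w::complex ^ 'm. cis (2 * pi * t) *s w) \<in> borel_measurable borel"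
      by (intro borel_measurable_continuous_onI continuous_intros)
    then have "(\<lambda>w. G (cis (2 * pi * t) *s w)) \<in> borel_measurable lborel"
      by simp
    then show "(\<integral>\<^sup>+w. G (cis (2 * pi * t) *s w) * indicator {0..1} t \<partial>lborel)
        = (\<integral>\<^sup>+w. G w \<partial>lborel) * indicator {0..1} t"
      by (simp add: nn_integral_multc rot)
  qed
  also have "\<dots> = (\<integral>\<^sup>+w. G w \<partial>lborel)"
    by (simp add: nn_integral_cmult)
  also have "\<dots> = (\<integral>\<^sup>+x. ennreal (cmod (indicator (ball z \<delta>) x * g x)) \<partial>lborel)"
    unfolding G_def
    by (rule nn_integral_lborel_translation[of "\<lambda>x. ennreal (cmod (indicator (ball z \<delta>) x * g x))"])
       (intro measurable_compose[OF meas], measurable)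
  also have "\<dots> = (\<integral>\<^sup>+x\<in>ball z \<delta>. ennreal (cmod (g x)) \<partial>lborel)"
    by (intro nn_integral_cong) (auto simp: indicator_def)
  finally show ?thesis .
qed

section \<open>Holomorphic derivatives and their growth\<close>

text \<open>The error constant depends on \<open>k\<close> only through \<open>M\<close> and
  \<open>r\<close>; this is what makes difference quotients converge uniformly over a family of
  functions.\<close>

lemma complex_linearization_bound:
  assumes hol: "k holomorphic_on ball 0 r" and "0 < r"
    and bnd: "\<And>u. u \<in> ball 0 r \<Longrightarrow> cmod (k u) \<le> M" and u: "cmod u \<le> r / 2"
  shows "cmod (k u - k 0 - deriv k 0 * u) \<le> 32 * (\<bar>M\<bar> + 1) / r\<^sup>2 * (cmod u)\<^sup>2"
proof -
  let ?S = "cball (0::complex) (r / 2)"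
  have sub: "?S \<subseteq> ball 0 r"
    using \<open>0 < r\<close> by auto
  have "cmod ((deriv ^^ 0) k u - (\<Sum>i\<le>1. (deriv ^^ i) k 0 * (u - 0) ^ i / fact i))
      \<le> (32 * (\<bar>M\<bar> + 1) / r\<^sup>2) * cmod (u - 0) ^ Suc 1 / fact 1"
  proof (rule complex_Taylor)
    show "((deriv ^^ i) k has_field_derivative (deriv ^^ Suc i) k x) (at x within ?S)"
      if "x \<in> ?S" for i x
    proof -
      have "(deriv ^^ i) k holomorphic_on ball 0 r"
        using hol by (rule holomorphic_higher_deriv) simp
      then have "((deriv ^^ i) k has_field_derivative deriv ((deriv ^^ i) k) x) (at x)"
        using that sub by (intro holomorphic_derivI[of _ "ball 0 r"]) auto
      then show ?thesis
        by (simp add: has_field_derivative_at_within)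
    qed
    show "cmod ((deriv ^^ Suc 1) k x) \<le> 32 * (\<bar>M\<bar> + 1) / r\<^sup>2" if x: "x \<in> ?S" for x
    proof -
      have in_ball: "w \<in> ball 0 r" if "w \<in> cball x (r / 4)" for w
      proof -
        have "cmod w \<le> cmod x + cmod (w - x)"
          by (rule norm_triangle_sub)
        moreover have "cmod (w - x) \<le> r / 4"
          using that by (simp add: dist_norm norm_minus_commute)
        ultimately show ?thesis
          using x \<open>0 < r\<close> by simp
      qed
      \<comment> \<open>Discs of radius \<open>r / 4\<close> about points of \<open>?S\<close> stay
        inside \<open>ball 0 r\<close>, and the right-hand side is
        \<open>32 * (\<bar>M\<bar> + 1) / r\<^sup>2\<close>. The \<open>+ 1\<close> is there because
        the Cauchy estimate asks for values in an open ball.\<close>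
      have "cmod ((deriv ^^ 2) k x) \<le> fact 2 * (\<bar>M\<bar> + 1) / (r / 4)\<^sup>2"
      proof (rule Cauchy_higher_deriv_bound)
        have "cball x (r / 4) \<subseteq> ball 0 r"
          using in_ball by blast
        then show "continuous_on (cball x (r / 4)) k" "k holomorphic_on ball x (r / 4)"
          using hol ball_subset_cball
          by (blast intro: holomorphic_on_imp_continuous_on holomorphic_on_subset)+
        show "k w \<in> ball 0 (\<bar>M\<bar> + 1)" if "w \<in> ball x (r / 4)" for w
          using bnd[of w] in_ball[of w] that by force
      qed (use \<open>0 < r\<close> in auto)
      then show ?thesis
        by (simp add: power2_eq_square numeral_2_eq_2)
    qed
  qed (use u \<open>0 < r\<close> in auto)
  then show ?thesis
    by (simp add: power2_eq_square algebra_simps)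
qed

text \<open>The derivative is a parameter so that its dependence on the point can be studied. The
  assumptions are pointwise on \<open>D\<close>; holomorphy along lines, measurability and growth of
  \<open>f'\<close> are proved from them.\<close>

locale complex_differentiable_on =
  fixes D :: "(complex ^ 'm) set" and f :: "complex ^ 'm \<Rightarrow> complex"
    and f' :: "complex ^ 'm \<Rightarrow> complex ^ 'm \<Rightarrow> complex"
  assumes open_D: "open D"
    and deriv: "z \<in> D \<Longrightarrow> (f has_derivative f' z) (at z)"
    and clinear: "z \<in> D \<Longrightarrow> f' z (c *s v) = c * f' z v"
begin

lemma continuous_on_f: "continuous_on D f"
  using deriv has_derivative_continuous by (intro continuous_at_imp_continuous_on) blast

lemma has_field_derivative_line:
  assumes "a + c *s w \<in> D"
  shows "((\<lambda>c. f (a + c *s w)) has_field_derivative f' (a + c *s w) w) (at c)"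
proof -
  have "((\<lambda>c. a + c *s w) has_derivative (\<lambda>c. c *s w)) (at c)"
    using bounded_linear.has_derivative[OF bounded_linear_vector_smult_left has_derivative_ident]
    by (intro derivative_eq_intros) auto
  from has_derivative_compose[OF this deriv[OF assms]]
  have "((\<lambda>c. f (a + c *s w)) has_derivative (\<lambda>t. f' (a + c *s w) (t *s w))) (at c)" .
  then show ?thesis
    unfolding has_field_derivative_def
    by (simp add: clinear[OF assms] mult.commute[of _ "f' _ _"])
qed

lemma open_line: "open {c. a + c *s w \<in> D}"
  using open_vimage[OF open_D, of "\<lambda>c. a + c *s w"] by (simp add: vimage_def continuous_intros)

lemma holomorphic_on_line: "(\<lambda>c. f (a + c *s w)) holomorphic_on {c. a + c *s w \<in> D}"
  using has_field_derivative_line open_line by (subst holomorphic_on_open) blast+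

text \<open>The difference quotients in direction \<open>v\<close> are holomorphic along the line and converge locally
  uniformly by the Cauchy estimates.\<close>

lemma holomorphic_on_line_deriv: "(\<lambda>c. f' (a + c *s w) v) holomorphic_on {c. a + c *s w \<in> D}"
proof -
  have "(\<lambda>c. f' (a + c *s w) v) field_differentiable (at c0)" if c0: "a + c0 *s w \<in> D" for c0
  proof -
    define z0 where "z0 = a + c0 *s w"
    obtain s where s: "0 < s" "cball z0 s \<subseteq> D"
      using open_D c0 unfolding z0_def open_contains_cball by blast
    have "compact (f ` cball z0 s)"
      using continuous_on_f s(2) by (intro compact_continuous_image) (auto intro: continuous_on_subset)
    then have "bounded (f ` cball z0 s)"
      by (rule compact_imp_bounded)
    then obtain M where M: "\<And>x. x \<in> cball z0 s \<Longrightarrow> cmod (f x) \<le> M"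
      unfolding bounded_iff by blast
    \<comment> \<open>One radius for both the parameter \<open>c\<close> and the increment
      \<open>u\<close>: together they move the point by at most \<open>s / 2\<close>, inside the
      ball where \<open>M\<close> bounds \<open>f\<close>. The summand 1 covers
      \<open>w = v = 0\<close>.\<close>
    define r where "r = s / (2 * (1 + norm w + norm v))"
    have r: "0 < r"
      using s(1) by (auto simp: r_def intro!: divide_pos_pos add_pos_nonneg)
    have in_ball: "a + c *s w + u *s v \<in> cball z0 s" if "c \<in> ball c0 r" "cmod u \<le> r" for c u
    proof -
      have rs: "r * (1 + norm w + norm v) = s / 2"
        using add_pos_nonneg[of "1 + norm w" "norm v"]
        by (simp add: r_def add_pos_nonneg divide_simps) (simp add: add_pos_nonneg less_imp_neq[symmetric])
      have eq: "a + c *s w + u *s v - z0 = (c - c0) *s w + u *s v"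
        by (simp add: z0_def vec_eq_iff algebra_simps)
      have "norm ((c - c0) *s w + u *s v) \<le> cmod (c - c0) * norm w + cmod u * norm v"
        by (rule norm_triangle_le) (simp only: norm_vector_smult_complex)
      also have "\<dots> \<le> r * norm w + r * norm v"
        using that by (intro add_mono mult_right_mono) (auto simp: dist_norm norm_minus_commute)
      also have "\<dots> \<le> s"
        using rs r s(1) by (simp add: algebra_simps)
      finally show ?thesis
        by (simp only: mem_cball dist_norm norm_minus_commute[of z0] eq)
    qed
    \<comment> \<open>The factor \<open>r / 2\<close> keeps the increments in the range of the
      linearization bound. Its quadratic error, divided by \<open>e n\<close>, gives the rate
      \<open>C * e n\<close>, uniformly in \<open>c\<close>.\<close>
    define e where "e n = r / 2 * inverse (real (Suc n))" for n
    have e: "0 < e n" "e n \<le> r / 2" for n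
      using r by (auto simp: e_def field_simps)
    define q where "q n c = (f (a + c *s w + of_real (e n) *s v) - f (a + c *s w)) / of_real (e n)" for n c
    define C where "C = 32 * (\<bar>M\<bar> + 1) / r\<^sup>2"
    have approx: "cmod (q n c - f' (a + c *s w) v) \<le> C * e n" if c: "c \<in> ball c0 r" for n c
    proof -
      let ?k = "\<lambda>u. f (a + c *s w + u *s v)"
      have D: "a + c *s w + u *s v \<in> D" if "u \<in> ball 0 r" for u
        using in_ball[OF c, of u] s(2) that by (auto simp: less_imp_le)
      have d: "deriv ?k 0 = f' (a + c *s w) v"
        using has_field_derivative_line[of "a + c *s w" 0 v] D[of 0] r by (intro DERIV_imp_deriv) simp
      have "cmod (?k (of_real (e n)) - ?k 0 - deriv ?k 0 * of_real (e n))
          \<le> 32 * (\<bar>M\<bar> + 1) / r\<^sup>2 * (cmod (of_real (e n)))\<^sup>2"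
      proof (rule complex_linearization_bound)
        show "?k holomorphic_on ball 0 r"
          by (rule holomorphic_on_subset[OF holomorphic_on_line]) (use D in auto)
        show "cmod (?k u) \<le> M" if "u \<in> ball 0 r" for u
          using in_ball[OF c, of u] M that by (auto simp: less_imp_le)
      qed (use r e[of n] in \<open>auto simp: abs_of_pos\<close>)
      then have "cmod (f (a + c *s w + of_real (e n) *s v) - f (a + c *s w) - f' (a + c *s w) v * of_real (e n))
          \<le> C * (e n)\<^sup>2"
        unfolding d C_def by simp
      moreover have "q n c - f' (a + c *s w) v
          = (f (a + c *s w + of_real (e n) *s v) - f (a + c *s w) - f' (a + c *s w) v * of_real (e n)) / of_real (e n)"
        using e[of n] by (simp add: q_def field_simps)
      ultimately show ?thesis
        using e[of n] by (simp add: norm_divide pos_divide_le_eq power2_eq_square mult.assoc)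
    qed
    have lim: "uniform_limit (ball c0 r) q (\<lambda>c. f' (a + c *s w) v) sequentially"
    proof (rule uniform_limitI)
      fix \<epsilon> :: real assume "0 < \<epsilon>"
      have "(\<lambda>n. C * e n) \<longlonglongrightarrow> C * (r / 2 * 0)"
        unfolding e_def by (intro tendsto_intros LIMSEQ_inverse_real_of_nat)
      then have "\<forall>\<^sub>F n in sequentially. C * e n < \<epsilon>"
        using \<open>0 < \<epsilon>\<close> by (intro order_tendstoD(2)) auto
      then show "\<forall>\<^sub>F n in sequentially. \<forall>c\<in>ball c0 r. dist (q n c) (f' (a + c *s w) v) < \<epsilon>"
        by eventually_elim (auto simp: dist_norm intro!: le_less_trans[OF approx])
    qed
    have "(\<lambda>c. f' (a + c *s w) v) holomorphic_on ball c0 r"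
    proof (rule holomorphic_uniform_sequence)
      show "q n holomorphic_on ball c0 r" for n
      proof -
        have "(\<lambda>c. f ((a + of_real (e n) *s v) + c *s w)) holomorphic_on ball c0 r"
          using in_ball[of _ "of_real (e n)"] s(2) e[of n] r
          by (intro holomorphic_on_subset[OF holomorphic_on_line]) (force simp: algebra_simps)
        moreover have "(\<lambda>c. f (a + c *s w)) holomorphic_on ball c0 r"
          using in_ball[of _ 0] s(2) r
          by (intro holomorphic_on_subset[OF holomorphic_on_line]) force
        ultimately show ?thesis
          unfolding q_def using e[of n] by (auto intro!: holomorphic_intros simp: add_ac)
      qed
      show "\<exists>d>0. cball c d \<subseteq> ball c0 r \<and> uniform_limit (cball c d) q (\<lambda>c. f' (a + c *s w) v) sequentially"
        if "c \<in> ball c0 r" for c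
        using open_ball that lim unfolding open_contains_cball by (meson uniform_limit_on_subset)
    qed simp
    then show ?thesis
      using r by (simp add: holomorphic_on_imp_differentiable_at)
  qed
  then show ?thesis
    unfolding holomorphic_on_def by (auto intro: field_differentiable_at_within)
qed

text \<open>So far \<open>f'\<close> is known to be regular only along single lines, so
  measurability is taken from a pointwise limit of difference quotients. Each quotient is cut off to
  the open set \<open>U n\<close> where both of its points lie in \<open>D\<close>; a point of
  \<open>D\<close> belongs to \<open>U n\<close> for all large \<open>n\<close>.\<close>

lemma borel_measurable_deriv: "(\<lambda>x. indicator D x * f' x v) \<in> borel_measurable borel"
proof (rule borel_measurable_LIMSEQ_metric)
  define e where "e n = inverse (real (Suc n))" for n
  define U where "U n = {x. x \<in> D \<and> x + e n *\<^sub>R v \<in> D}" for n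
  define h where "h n x = indicator (U n) x *\<^sub>R ((f (x + e n *\<^sub>R v) - f x) / of_real (e n))" for n x
  have "open (U n)" for n
    using open_Int[OF open_D open_vimage[OF open_D, of "\<lambda>x. x + e n *\<^sub>R v"]]
    by (simp add: U_def vimage_def Int_def continuous_intros)
  have "continuous_on (U n) (\<lambda>x. f (x + e n *\<^sub>R v))" for n
    by (rule continuous_on_compose2[OF continuous_on_f]) (auto intro!: continuous_intros simp: U_def)
  moreover have "continuous_on (U n) f" for n
    using continuous_on_f by (rule continuous_on_subset) (auto simp: U_def)
  ultimately show "h n \<in> borel_measurable borel" for n
    unfolding h_def using \<open>\<And>n. open (U n)\<close>
    by (intro borel_measurable_continuous_on_indicator continuous_intros) (simp_all add: e_def del: of_nat_Suc)
  have e_pos: "e n \<noteq> 0" for n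
    by (simp add: e_def del: of_nat_Suc)
  have e0: "e \<longlonglongrightarrow> 0"
    unfolding e_def by (rule LIMSEQ_inverse_real_of_nat)
  show "(\<lambda>n. h n x) \<longlonglongrightarrow> indicator D x * f' x v" for x
  proof (cases "x \<in> D")
    case True
    have xv: "((\<lambda>n. x + e n *\<^sub>R v) \<longlongrightarrow> x + 0 *\<^sub>R v) sequentially"
      by (intro tendsto_intros e0)
    then have "\<forall>\<^sub>F n in sequentially. x + e n *\<^sub>R v \<in> D"
      using open_D True by (auto dest: topological_tendstoD)
    then have "\<forall>\<^sub>F n in sequentially. (f (x + e n *\<^sub>R v) - f x) / of_real (e n) = h n x"
      by eventually_elim (use True in \<open>simp add: h_def U_def\<close>)
    moreover have "(\<lambda>n. (f (x + e n *\<^sub>R v) - f x) / of_real (e n)) \<longlonglongrightarrow> f' x v"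
    proof -
      have "x + 0 *s v \<in> D"
        using True by simp
      from has_field_derivative_line[OF this]
      have "((\<lambda>c. (f (x + c *s v) - f x) / c) \<longlongrightarrow> f' x v) (at 0)"
        by (simp add: has_field_derivative_iff)
      moreover have "filterlim (\<lambda>n. complex_of_real (e n)) (at 0) sequentially"
        using tendsto_of_real[OF e0] unfolding filterlim_at using e_pos by auto
      ultimately have "(\<lambda>n. (f (x + of_real (e n) *s v) - f x) / of_real (e n)) \<longlonglongrightarrow> f' x v"
        by (rule filterlim_compose)
      moreover have "of_real t *s v = t *\<^sub>R v" for t :: real
        by (simp add: vec_eq_iff) (simp add: scaleR_conv_of_real)
      ultimately show ?thesis
        by simp
    qed
    ultimately show ?thesis
      using True by (auto intro: Lim_transform_eventually)
  qed (simp add: h_def U_def)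
qed

text \<open>Sub-mean value property of \<open>\<lambda>x. f' x v\<close> combined with \<open>t \<le> s + t\<^sup>q s\<^sup>1\<^sup>-\<^sup>q\<close>, where
  \<open>s\<close> is chosen to balance the two terms.\<close>

lemma deriv_bound_of_Lq:
  assumes "1 \<le> q" "0 \<le> M" "0 < \<delta>" "ball z \<delta> \<subseteq> D"
    and Lq: "(\<integral>\<^sup>+x\<in>D. ennreal (cmod (f' x v) powr q) \<partial>lborel) \<le> ennreal M"
  defines "N \<equiv> DIM(complex ^ 'm)"
  shows "cmod (f' z v) \<le> (1 + M / unit_ball_vol N) * \<delta> powr - (real N / q)"
proof -
  let ?B = "ball z \<delta>"
  define s where "s = \<delta> powr - (real N / q)"
  have s: "0 < s" using \<open>0 < \<delta>\<close> by (simp add: s_def)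
  \<comment> \<open>With this identity both terms of the split, integrated over the ball, are
    multiples of \<open>s * \<delta> ^ N\<close>. Dividing by \<open>V\<close> leaves the constant
    \<open>1 + M / unit_ball_vol N\<close>.\<close>
  have sq: "s powr (1 - q) = s * \<delta> ^ N"
  proof -
    have "s powr (1 - q) = s * s powr (- q)"
      using s by (simp add: powr_diff powr_minus_divide)
    also have "s powr (- q) = \<delta> powr real N"
      using \<open>1 \<le> q\<close> by (simp add: s_def powr_powr)
    finally show ?thesis
      using \<open>0 < \<delta>\<close> by (simp add: powr_realpow)
  qed
  define V where "V = unit_ball_vol (real N) * \<delta> ^ N"
  have V: "0 < V" "emeasure lborel ?B = ennreal V"
    using \<open>0 < \<delta>\<close> by (simp_all add: V_def N_def emeasure_ball)
  have split: "t \<le> s + t powr q * s powr (1 - q)" if "0 \<le> t" for t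
  proof (cases "t \<le> s")
    case False
    then have "t = t powr q * t powr (1 - q)"
      using s by (simp flip: powr_add)
    also have "\<dots> \<le> t powr q * s powr (1 - q)"
      using False s \<open>1 \<le> q\<close> by (intro mult_left_mono powr_mono2') auto
    finally show ?thesis
      using s by simp
  qed (simp add: add_increasing2)
  have [measurable]: "?B \<in> sets borel"
    by simp
  note borel_measurable_deriv[measurable]
  have [measurable]: "(\<lambda>x. indicator ?B x * f' x v) \<in> borel_measurable borel"
  proof -
    have "(\<lambda>x. indicator ?B x * (indicator D x * f' x v)) \<in> borel_measurable borel"
      by measurable
    moreover have "indicator ?B x * (indicator D x * f' x v) = indicator ?B x * f' x v" for x
      using assms(4) by (auto simp: indicator_def)
    ultimately show ?thesis
      by simp
  qed
  have "ennreal (cmod (f' z v) * V) = ennreal (cmod (f' z v)) * emeasure lborel ?B"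
    using V by (simp add: ennreal_mult less_imp_le)
  also have "\<dots> \<le> (\<integral>\<^sup>+x\<in>?B. ennreal (cmod (f' x v)) \<partial>lborel)"
  proof (rule sub_mean_value_ball)
    fix w :: "complex ^ 'm" assume w: "w \<in> ball 0 \<delta>"
    show "\<exists>S. open S \<and> cball 0 1 \<subseteq> S \<and> (\<lambda>c. f' (z + c *s w) v) holomorphic_on S"
    proof (intro exI conjI)
      show "cball 0 1 \<subseteq> {c. z + c *s w \<in> D}"
      proof
        fix c :: complex assume "c \<in> cball 0 1"
        then have "norm (c *s w) < \<delta>"
          using w mult_right_mono[of "cmod c" 1 "norm w"] by (simp add: norm_vector_smult_complex)
        then show "c \<in> {c. z + c *s w \<in> D}"
          using assms(4) by (auto simp: dist_norm subset_iff)
      qed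
    qed (rule open_line holomorphic_on_line_deriv)+
  qed measurable
  also have "\<dots> \<le> (\<integral>\<^sup>+x. ennreal s * indicator ?B x
      + ennreal (s powr (1 - q)) * ennreal (cmod (indicator ?B x * f' x v) powr q) \<partial>lborel)"
    using split[OF norm_ge_zero] s by (intro nn_integral_mono)
      (auto simp: indicator_def mult.commute[of "ennreal (s powr _)"]
        simp flip: ennreal_plus ennreal_mult intro!: ennreal_leI)
  also have "\<dots> = ennreal s * ennreal V
      + ennreal (s powr (1 - q)) * (\<integral>\<^sup>+x. ennreal (cmod (indicator ?B x * f' x v) powr q) \<partial>lborel)"
    by (subst nn_integral_add) (auto simp: nn_integral_cmult nn_integral_cmult_indicator V(2))
  also have "\<dots> \<le> ennreal s * ennreal V + ennreal (s powr (1 - q)) * ennreal M"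
  proof -
    have "(\<integral>\<^sup>+x. ennreal (cmod (indicator ?B x * f' x v) powr q) \<partial>lborel)
        \<le> (\<integral>\<^sup>+x\<in>D. ennreal (cmod (f' x v) powr q) \<partial>lborel)"
      using assms(1,4) by (intro nn_integral_mono) (auto simp: indicator_def)
    then show ?thesis
      using Lq by (intro add_left_mono mult_left_mono) (auto intro: order_trans)
  qed
  also have "\<dots> = ennreal (s * V + s * \<delta> ^ N * M)"
    using s V \<open>0 \<le> M\<close> \<open>0 < \<delta>\<close> by (simp add: sq ennreal_mult ennreal_plus less_imp_le)
  finally have "cmod (f' z v) * V \<le> s * V + s * \<delta> ^ N * M"
    using s V \<open>0 \<le> M\<close> \<open>0 < \<delta>\<close> by (subst (asm) ennreal_le_iff) auto
  also have "\<dots> = ((1 + M / unit_ball_vol N) * s) * V"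
    using less_imp_neq[OF unit_ball_vol_pos[of "real N", OF of_nat_0_le_iff]] by (simp add: V_def field_simps)
  finally show ?thesis
    using V(1) by (simp add: s_def)
qed

lemma dz_eq:
  assumes "z \<in> D"
  shows "dz j f z = f' z (axis j 1)"
proof -
  have dir: "dir_deriv f v z = f' z v" for v
  proof -
    have "((\<lambda>t. z + t *\<^sub>R v) has_derivative (\<lambda>h. h *\<^sub>R v)) (at 0)"
      by (auto intro!: derivative_eq_intros)
    moreover have "(f has_derivative f' z) (at (z + 0 *\<^sub>R v))"
      using deriv[OF assms] by simp
    ultimately have "((\<lambda>t. f (z + t *\<^sub>R v)) has_derivative (\<lambda>h. f' z (h *\<^sub>R v))) (at 0)"
      by (rule has_derivative_compose)
    then have "((\<lambda>t. f (z + t *\<^sub>R v)) has_vector_derivative f' z v) (at 0)"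
      using linear_cmul[OF has_derivative_linear[OF deriv[OF assms]]]
      by (simp add: has_vector_derivative_def)
    then show ?thesis
      unfolding dir_deriv_def by (rule vector_derivative_at)
  qed
  \<comment> \<open>By complex linearity the derivative along \<open>axis j \<i>\<close> is
    \<open>\<i>\<close> times the one along \<open>axis j 1\<close>, so the two halves of the
    Wirtinger operator agree.\<close>
  have "axis j \<i> = \<i> *s axis j 1"
    by (simp add: vec_eq_iff axis_def)
  then show ?thesis
    unfolding dz_def dir using clinear[OF assms] by simp
qed

text \<open>This is the case \<open>q = 2 * p\<close> of the preceding growth bound:
  \<open>DIM(complex ^ 'm)\<close> is \<open>2 * CARD('m)\<close>, and the factors 2 cancel in the
  exponent.\<close>

lemma deriv_bound_of_in_Lp:
  assumes "real CARD('m) < p" and Lp: "in_Lp p D (\<lambda>z. dz j f z * cnj (dz j f z))"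
  obtains C where "0 \<le> C" "\<And>z \<delta>. 0 < \<delta> \<Longrightarrow> ball z \<delta> \<subseteq> D \<Longrightarrow>
    cmod (f' z (axis j 1)) \<le> C * \<delta> powr - (real CARD('m) / p)"
proof -
  define M where "M = (\<integral>z. cmod (dz j f z * cnj (dz j f z)) powr p \<partial>lebesgue_on D)"
  have "1 \<le> real CARD('m)"
    by (simp add: Suc_leI)
  then have p: "1 < p"
    using assms(1) by linarith
  have "0 \<le> M"
    unfolding M_def by (rule Bochner_Integration.integral_nonneg) simp
  have sq: "cmod (w * cnj w) powr p = cmod w powr (2 * p)" for w
    by (simp add: norm_mult powr_mult flip: powr_add)
  have "(\<integral>\<^sup>+x\<in>D. ennreal (cmod (f' x (axis j 1)) powr (2 * p)) \<partial>lborel)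
      = (\<integral>\<^sup>+x\<in>D. ennreal (cmod (dz j f x * cnj (dz j f x)) powr p) \<partial>lborel)"
    by (intro nn_integral_cong) (simp only: sq, simp add: indicator_def dz_eq)
  \<comment> \<open>The L^p hypothesis lives on the completed measure, the averaging argument on
    Borel sets; nonnegative integrals do not see the completion.\<close>
  also have "\<dots> = (\<integral>\<^sup>+x\<in>D. ennreal (cmod (dz j f x * cnj (dz j f x)) powr p) \<partial>lebesgue)"
    by (simp add: nn_integral_completion)
  also have "\<dots> = (\<integral>\<^sup>+x. ennreal (cmod (dz j f x * cnj (dz j f x)) powr p) \<partial>lebesgue_on D)"
    using open_D by (subst nn_integral_restrict_space) auto
  also have "\<dots> = ennreal M"
    unfolding M_def using Lp by (intro nn_integral_eq_integral) (auto simp: in_Lp_def)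
  finally have le: "(\<integral>\<^sup>+x\<in>D. ennreal (cmod (f' x (axis j 1)) powr (2 * p)) \<partial>lborel) \<le> ennreal M"
    by simp
  show thesis
  proof (rule that)
    show "cmod (f' z (axis j 1)) \<le> (1 + M / unit_ball_vol (real DIM(complex ^ 'm))) * \<delta> powr - (real CARD('m) / p)"
      if "0 < \<delta>" "ball z \<delta> \<subseteq> D" for z \<delta>
      using deriv_bound_of_Lq[OF _ \<open>0 \<le> M\<close> that le] p by simp
  qed (use \<open>0 \<le> M\<close> in simp)
qed

end

section \<open>Boundary limits\<close>

lemma continuous_extension_to_closure:
  fixes f :: "'a::metric_space \<Rightarrow> 'b::metric_space"
  assumes cont: "continuous_on D f"
    and lim: "\<And>z. z \<in> closure D \<Longrightarrow> \<exists>l. (f \<longlongrightarrow> l) (at z within D)"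
  obtains g where "continuous_on (closure D) g" "\<And>z. z \<in> D \<Longrightarrow> g z = f z"
    "\<And>z. z \<in> closure D \<Longrightarrow> (f \<longlongrightarrow> g z) (at z within D)"
proof -
  \<comment> \<open>At an isolated point of \<open>D\<close> every \<open>l\<close> is a limit, so
    the value \<open>f z\<close> has to be prescribed on \<open>D\<close>.\<close>
  have "\<exists>l. (f \<longlongrightarrow> l) (at z within D) \<and> (z \<in> D \<longrightarrow> l = f z)" if "z \<in> closure D" for z
    using lim[OF that] cont unfolding continuous_on_def by (cases "z \<in> D") auto
  then obtain g where g: "\<And>z. z \<in> closure D \<Longrightarrow> (f \<longlongrightarrow> g z) (at z within D) \<and> (z \<in> D \<longrightarrow> g z = f z)"
    by metis
  have near: "\<exists>d>0. \<forall>x\<in>D. dist x z < d \<longrightarrow> dist (f x) (g z) < e" if z: "z \<in> closure D" and "0 < e" for z e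
  proof -
    obtain d where d: "0 < d" "\<And>x. x \<in> D \<Longrightarrow> 0 < dist x z \<Longrightarrow> dist x z < d \<Longrightarrow> dist (f x) (g z) < e"
      using g[OF z] \<open>0 < e\<close> unfolding Lim_within by blast
    have "dist (f x) (g z) < e" if "x \<in> D" "dist x z < d" for x
      using d(2)[of x] that g[OF z] \<open>0 < e\<close> by (cases "x = z") auto
    then show ?thesis
      using d(1) by blast
  qed
  have "continuous_on (closure D) g"
    unfolding continuous_on_iff
  proof (intro ballI allI impI)
    fix z and e :: real assume z: "z \<in> closure D" and "0 < e"
    obtain d where d: "0 < d" "\<And>x. x \<in> D \<Longrightarrow> dist x z < d \<Longrightarrow> dist (f x) (g z) < e / 2"
      using near[OF z, of "e / 2"] \<open>0 < e\<close> by auto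
    have "dist (g y) (g z) < e" if y: "y \<in> closure D" "dist y z < d" for y
    proof -
      obtain d' where d': "0 < d'" "\<And>x. x \<in> D \<Longrightarrow> dist x y < d' \<Longrightarrow> dist (f x) (g y) < e / 2"
        using near[OF y(1), of "e / 2"] \<open>0 < e\<close> by auto
      obtain x where x: "x \<in> D" "dist x y < min d' (d - dist y z)"
        using y d'(1) unfolding closure_approachable
        by (metis diff_gt_0_iff_gt min_less_iff_conj)
      have "dist x z < d"
        using x(2) dist_triangle[of x z y] by simp
      then have "dist (f x) (g z) < e / 2" "dist (f x) (g y) < e / 2"
        using d(2) d'(2) x by simp_all
      then show ?thesis
        using dist_triangle[of "g y" "g z" "f x"] by (simp add: dist_commute)
    qed
    then show "\<exists>d>0. \<forall>y\<in>closure D. dist y z < d \<longrightarrow> dist (g y) (g z) < e"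
      using d(1) by blast
  qed
  then show thesis
    using that g closure_subset by blast
qed

lemma tendsto_within_if_Cauchy:
  fixes f :: "'a::metric_space \<Rightarrow> 'b::complete_space"
  assumes "z \<in> closure D"
    and Cauchy: "\<And>e. 0 < e \<Longrightarrow>
      \<exists>d>0. \<forall>x\<in>D. \<forall>y\<in>D. dist x z < d \<longrightarrow> dist y z < d \<longrightarrow> dist (f x) (f y) < e"
  shows "\<exists>l. (f \<longlongrightarrow> l) (at z within D)"
proof -
  obtain X where X: "\<And>n. X n \<in> D" "X \<longlonglongrightarrow> z"
    using assms(1) unfolding closure_sequential by blast
  have "Cauchy (\<lambda>n. f (X n))"
    unfolding Cauchy_def
  proof (intro allI impI)
    fix e :: real assume "0 < e"
    then obtain d where d: "0 < d" "\<And>x y. x \<in> D \<Longrightarrow> y \<in> D \<Longrightarrow> dist x z < d \<Longrightarrow> dist y z < d \<Longrightarrow> dist (f x) (f y) < e"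
      using Cauchy by blast
    obtain N where "\<And>n. n \<ge> N \<Longrightarrow> dist (X n) z < d"
      using X(2) d(1) unfolding lim_sequentially by blast
    then show "\<exists>M. \<forall>m\<ge>M. \<forall>n\<ge>M. dist (f (X m)) (f (X n)) < e"
      using d(2) X(1) by blast
  qed
  then obtain l where l: "(\<lambda>n. f (X n)) \<longlonglongrightarrow> l"
    using Cauchy_convergent convergent_def by blast
  have "(f \<longlongrightarrow> l) (at z within D)"
    unfolding Lim_within
  proof (intro allI impI)
    fix e :: real assume "0 < e"
    then obtain d where d: "0 < d" "\<And>x y. x \<in> D \<Longrightarrow> y \<in> D \<Longrightarrow> dist x z < d \<Longrightarrow> dist y z < d \<Longrightarrow> dist (f x) (f y) < e / 2"
      using Cauchy[of "e / 2"] by auto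
    have "\<forall>\<^sub>F n in sequentially. dist (X n) z < d \<and> dist (f (X n)) l < e / 2"
      using tendstoD[OF X(2) d(1)] tendstoD[OF l, of "e / 2"] \<open>0 < e\<close> by (simp add: eventually_conj)
    then obtain n where n: "dist (X n) z < d" "dist (f (X n)) l < e / 2"
      by (metis (mono_tags, lifting) eventually_happens sequentially_bot)
    have "dist (f x) l < e" if "x \<in> D" "dist x z < d" for x
      using d(2)[OF that(1) X(1)[of n] that(2) n(1)] n(2) dist_triangle[of "f x" l "f (X n)"] by simp
    then show "\<exists>d>0. \<forall>x\<in>D. 0 < dist x z \<and> dist x z < d \<longrightarrow> dist (f x) l < e"
      using d(1) by blast
  qed
  then show ?thesis
    by blast
qed

text \<open>Comparing \<open>f x\<close> and \<open>f y\<close> with the values at the points \<open>x + t e\<close> and \<open>y + t e\<close> well inside \<open>D\<close>: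
  the assumed blow-up rate of the derivative is integrable along the segments.\<close>

lemma tendsto_within_if_derivative_bound:
  fixes f :: "'a::real_normed_vector \<Rightarrow> 'b::banach"
  assumes "\<zeta> \<in> closure D" and "0 < \<rho>" "0 < \<kappa>" "\<alpha> < 1"
    and cone: "\<And>x t. x \<in> closure D \<Longrightarrow> dist x \<zeta> < \<rho> \<Longrightarrow> 0 < t \<Longrightarrow> t < \<rho> \<Longrightarrow> ball (x + t *\<^sub>R e) (\<kappa> * t) \<subseteq> D"
    and deriv: "\<And>z. z \<in> D \<Longrightarrow> (f has_derivative f' z) (at z)"
    and bound: "\<And>z \<delta>. 0 < \<delta> \<Longrightarrow> ball z \<delta> \<subseteq> D \<Longrightarrow> norm (f' z e) \<le> C * \<delta> powr - \<alpha>"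
  shows "\<exists>l. (f \<longlongrightarrow> l) (at \<zeta> within D)"
proof (rule tendsto_within_if_Cauchy)
  \<comment> \<open>\<open>K * t powr (1 - \<alpha>)\<close> is the antiderivative of
    \<open>C * (\<kappa> * t) powr - \<alpha>\<close> that vanishes at 0; this is where
    \<open>\<alpha> < 1\<close> enters.\<close>
  define K where "K = C * \<kappa> powr - \<alpha> / (1 - \<alpha>)"
  have inD: "x + t *\<^sub>R e \<in> D" if "x \<in> closure D" "dist x \<zeta> < \<rho>" "0 < t" "t < \<rho>" for x t
    using cone[OF that] \<open>0 < \<kappa>\<close> that by force
  have step: "norm (f (x + t *\<^sub>R e) - f x) \<le> K * t powr (1 - \<alpha>)"
    if x: "x \<in> D" "dist x \<zeta> < \<rho>" and t: "0 < t" "t < \<rho>" for x t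
  proof -
    have xc: "x \<in> closure D"
      using x closure_subset by blast
    have xs: "x + s *\<^sub>R e \<in> D" if "0 \<le> s" "s \<le> t" for s
      using inD[OF xc x(2), of s] x that t by (cases "s = 0") auto
    have der: "((\<lambda>s. f (x + s *\<^sub>R e)) has_vector_derivative f' (x + s *\<^sub>R e) e) (at s)"
      if "0 \<le> s" "s \<le> t" for s
    proof -
      have "((\<lambda>s. x + s *\<^sub>R e) has_derivative (\<lambda>h. h *\<^sub>R e)) (at s)"
        by (auto intro!: derivative_eq_intros)
      from has_derivative_compose[OF this deriv[OF xs[OF that]]]
      show ?thesis
        using linear_cmul[OF has_derivative_linear[OF deriv[OF xs[OF that]]]]
        by (simp add: has_vector_derivative_def)
    qed
    \<comment> \<open>The mean value inequality compares derivatives only on the open interval, so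
      the singularity of the bound at \<open>s = 0\<close> is harmless: the majorant itself is
      continuous there.\<close>
    have "norm (f (x + t *\<^sub>R e) - f (x + 0 *\<^sub>R e)) \<le> K * t powr (1 - \<alpha>) - K * 0 powr (1 - \<alpha>)"
    proof (rule differentiable_bound_general[where f = "\<lambda>s. f (x + s *\<^sub>R e)"
          and \<phi>' = "\<lambda>s. C * (\<kappa> * s) powr - \<alpha>"])
      show "continuous_on {0..t} (\<lambda>s. f (x + s *\<^sub>R e))"
        by (intro continuous_at_imp_continuous_on ballI has_vector_derivative_continuous[OF der]) auto
      show "continuous_on {0..t} (\<lambda>s. K * s powr (1 - \<alpha>))"
        using \<open>\<alpha> < 1\<close> by (intro continuous_intros continuous_on_powr') auto
      show "((\<lambda>s. K * s powr (1 - \<alpha>)) has_vector_derivative C * (\<kappa> * s) powr - \<alpha>) (at s)" if "0 < s" for s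
        unfolding has_real_derivative_iff_has_vector_derivative[symmetric]
        using that \<open>\<alpha> < 1\<close> \<open>0 < \<kappa>\<close>
        by (auto intro!: derivative_eq_intros simp: K_def powr_mult)
      show "norm (f' (x + s *\<^sub>R e) e) \<le> C * (\<kappa> * s) powr - \<alpha>" if "0 < s" "s < t" for s
        using cone[OF xc x(2), of s] that t \<open>0 < \<kappa>\<close> by (intro bound) auto
    qed (use t der in auto)
    then show ?thesis
      by simp
  qed
  fix \<epsilon> :: real assume "0 < \<epsilon>"
  have "((\<lambda>t. K * t powr (1 - \<alpha>)) \<longlongrightarrow> K * 0 powr (1 - \<alpha>)) (at_right 0)"
    using \<open>\<alpha> < 1\<close>
    by (intro tendsto_mult tendsto_const tendsto_powr') (auto simp: eventually_at_filter)
  then have "\<forall>\<^sub>F t in at_right 0. K * t powr (1 - \<alpha>) < \<epsilon> / 4"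
    using \<open>0 < \<epsilon>\<close> by (intro order_tendstoD(2)) auto
  moreover have "\<forall>\<^sub>F t in at_right 0. 0 < t \<and> t < \<rho>"
    using \<open>0 < \<rho>\<close> by (auto simp: eventually_at_right_field)
  ultimately have "\<forall>\<^sub>F t in at_right 0. K * t powr (1 - \<alpha>) < \<epsilon> / 4 \<and> 0 < t \<and> t < \<rho>"
    by (rule eventually_conj)
  then obtain t where t: "K * t powr (1 - \<alpha>) < \<epsilon> / 4" "0 < t" "t < \<rho>"
    using eventually_happens[of _ "at_right (0::real)"] by auto
  \<comment> \<open>From here \<open>t\<close> is fixed. The distance from
    \<open>x + t *\<^sub>R e\<close> to this point equals that from \<open>x\<close> to
    \<open>\<zeta>\<close>, so continuity of \<open>f\<close> at a single interior point controls
    all nearby \<open>x\<close>.\<close>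
  have "\<zeta> + t *\<^sub>R e \<in> D"
    using inD[OF assms(1), of t] t \<open>0 < \<rho>\<close> by simp
  then have "isCont f (\<zeta> + t *\<^sub>R e)"
    using deriv has_derivative_continuous by blast
  then obtain d where d: "0 < d" "\<And>y. dist y (\<zeta> + t *\<^sub>R e) < d \<Longrightarrow> dist (f y) (f (\<zeta> + t *\<^sub>R e)) < \<epsilon> / 4"
    using \<open>0 < \<epsilon>\<close> unfolding continuous_at_eps_delta by (metis divide_pos_pos zero_less_numeral)
  have near: "dist (f x) (f (\<zeta> + t *\<^sub>R e)) < \<epsilon> / 2" if "x \<in> D" "dist x \<zeta> < min d \<rho>" for x
  proof -
    have "dist (f (x + t *\<^sub>R e)) (f (\<zeta> + t *\<^sub>R e)) < \<epsilon> / 4"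
      using that by (intro d) simp
    moreover have "dist (f x) (f (x + t *\<^sub>R e)) < \<epsilon> / 4"
      using step[of x t] that t by (simp add: dist_norm norm_minus_commute)
    ultimately show ?thesis
      using dist_triangle[of "f x" "f (\<zeta> + t *\<^sub>R e)" "f (x + t *\<^sub>R e)"] by simp
  qed
  have "dist (f x) (f y) < \<epsilon>" if "x \<in> D" "y \<in> D" "dist x \<zeta> < min d \<rho>" "dist y \<zeta> < min d \<rho>" for x y
    using near[OF that(1,3)] near[OF that(2,4)] dist_triangle2[of "f x" "f y" "f (\<zeta> + t *\<^sub>R e)"] by simp
  then show "\<exists>d>0. \<forall>x\<in>D. \<forall>y\<in>D. dist x \<zeta> < d \<longrightarrow> dist y \<zeta> < d \<longrightarrow> dist (f x) (f y) < \<epsilon>"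
    using d(1) \<open>0 < \<rho>\<close> by (intro exI[of _ "min d \<rho>"]) auto
qed (rule assms(1))

section \<open>Interior cones from a local defining function\<close>

text \<open>The set where \<open>r\<close> is positive is open in \<open>U\<close> and misses
  \<open>D\<close>. This admits boundary points as vertices of the cones, in particular \<zeta>
  itself.\<close>

lemma local_defining_function_nonpos:
  assumes "local_defining_function D \<zeta> U r" "x \<in> closure D" "x \<in> U"
  shows "r x \<le> 0"
proof (rule ccontr)
  assume "\<not> r x \<le> 0"
  have U: "open U" "D \<inter> U = {z\<in>U. r z < 0}"
    using assms(1) by (auto simp: local_defining_function_def)
  have "continuous_on U r"
    using assms(1) has_derivative_continuous unfolding local_defining_function_def C2_on_def
    by (intro continuous_at_imp_continuous_on) blast
  then have "open (r -` {0<..} \<inter> U)"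
    using U(1) by (simp add: continuous_on_open_vimage)
  moreover have "x \<in> r -` {0<..} \<inter> U"
    using assms(3) \<open>\<not> r x \<le> 0\<close> by simp
  ultimately obtain y where "y \<in> D" "y \<in> U" "0 < r y"
    using assms(2) unfolding closure_iff_nhds_not_empty by blast
  then show False
    using U(2) by (metis (mono_tags, lifting) IntI mem_Collect_eq not_less_iff_gr_or_eq)
qed

text \<open>Points of the ball about \<open>x + t *\<^sub>R e\<close> are
  \<open>x + t *\<^sub>R v\<close> with \<open>v\<close> within \<open>\<kappa>\<close> of
  \<open>e\<close>. Since \<open>r'\<close> is continuous and negative on \<open>e\<close> at
  \<zeta>, it is negative on all such \<open>v\<close> at all points near \<zeta>. Thus
  \<open>r\<close> strictly decreases from \<open>r x \<le> 0\<close> along the segment.\<close>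

lemma interior_cone_at_boundary:
  assumes ldf: "local_defining_function D \<zeta> U r"
  obtains e \<kappa> \<rho> where "0 < \<kappa>" "0 < \<rho>"
    "\<And>x t. x \<in> closure D \<Longrightarrow> dist x \<zeta> < \<rho> \<Longrightarrow> 0 < t \<Longrightarrow> t < \<rho> \<Longrightarrow> ball (x + t *\<^sub>R e) (\<kappa> * t) \<subseteq> D"
proof -
  have U: "open U" "\<zeta> \<in> U" "D \<inter> U = {z\<in>U. r z < 0}"
    using ldf by (auto simp: local_defining_function_def)
  obtain r' r'' where r': "\<And>x. x \<in> U \<Longrightarrow> (r has_derivative blinfun_apply (r' x)) (at x)"
    and r'': "\<And>x. x \<in> U \<Longrightarrow> (r' has_derivative blinfun_apply (r'' x)) (at x)"
    using ldf unfolding local_defining_function_def C2_on_def by blast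
  have "blinfun_apply (r' \<zeta>) \<noteq> (\<lambda>v. 0)"
    using ldf U(2) frechet_derivative_at[OF r'[OF U(2)]] by (auto simp: local_defining_function_def)
  then obtain v where "r' \<zeta> v \<noteq> 0"
    by blast
  then obtain e where e: "r' \<zeta> e < 0"
    using blinfun.minus_right[of "r' \<zeta>" v] by (cases "r' \<zeta> v < 0") (auto intro: that[of "- v"])
  define a where "a = - r' \<zeta> e"
  have a: "0 < a" using e by (simp add: a_def)
  \<comment> \<open>Replacing \<open>e\<close> by \<open>v\<close> and replacing \<zeta> by
    \<open>x\<close> may each raise the derivative \<open>- a\<close> by at most
    \<open>a / 4\<close>; \<open>\<kappa>\<close> pays for the first and \<open>\<epsilon>\<close>
    for the second. The cap 1 gives \<open>norm v \<le> norm e + 1\<close>.\<close>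
  define \<kappa> where "\<kappa> = min 1 (a / (4 * (norm (r' \<zeta>) + 1)))"
  have \<kappa>: "0 < \<kappa>" "\<kappa> \<le> 1"
    using a by (auto simp: \<kappa>_def add_nonneg_pos)
  have \<kappa>a: "norm (r' \<zeta>) * \<kappa> \<le> a / 4"
  proof -
    have "norm (r' \<zeta>) * \<kappa> \<le> (norm (r' \<zeta>) + 1) * (a / (4 * (norm (r' \<zeta>) + 1)))"
      using a by (intro mult_mono) (auto simp: \<kappa>_def)
    also have "\<dots> = a / 4"
      using norm_ge_zero[of "r' \<zeta>"] by (simp add: field_simps add_nonneg_eq_0_iff)
    finally show ?thesis .
  qed
  define \<epsilon> where "\<epsilon> = a / (4 * (norm e + 1))"
  have \<epsilon>: "0 < \<epsilon>" "\<epsilon> * (norm e + 1) = a / 4"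
  proof -
    have "0 < norm e + 1"
      by (simp add: add_nonneg_pos)
    then show "0 < \<epsilon>" "\<epsilon> * (norm e + 1) = a / 4"
      unfolding \<epsilon>_def using a by (auto intro!: divide_pos_pos mult_pos_pos simp: divide_eq_eq)
  qed
  have "isCont r' \<zeta>"
    using r''[OF U(2)] by (rule has_derivative_continuous)
  then obtain d1 where d1: "0 < d1" "\<And>x. dist x \<zeta> < d1 \<Longrightarrow> dist (r' x) (r' \<zeta>) < \<epsilon>"
    using \<epsilon>(1) unfolding continuous_at_eps_delta by blast
  obtain d2 where d2: "0 < d2" "ball \<zeta> d2 \<subseteq> U"
    using U(1,2) open_contains_ball by blast
  define d where "d = min d1 d2"
  have "0 < d" using d1 d2 by (simp add: d_def)
  have neg: "r' x v < 0" if x: "dist x \<zeta> < d" and v: "norm (v - e) < \<kappa>" for x v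
  proof -
    have "r' x v = - a + r' \<zeta> (v - e) + (r' x - r' \<zeta>) v"
      by (simp add: a_def blinfun.diff_left blinfun.diff_right)
    moreover have "r' \<zeta> (v - e) \<le> a / 4"
    proof -
      have "r' \<zeta> (v - e) \<le> norm (r' \<zeta>) * norm (v - e)"
        using norm_blinfun[of "r' \<zeta>" "v - e"] by simp
      also have "\<dots> \<le> norm (r' \<zeta>) * \<kappa>"
        using v by (intro mult_left_mono) auto
      finally show ?thesis
        using \<kappa>a by simp
    qed
    moreover have "(r' x - r' \<zeta>) v \<le> a / 4"
    proof -
      have "norm v \<le> norm e + 1"
        using norm_triangle_sub[of v e] v \<kappa>(2) by simp
      moreover have "norm (r' x - r' \<zeta>) \<le> \<epsilon>"
        using d1(2)[of x] x by (simp add: d_def dist_norm)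
      ultimately have "norm (r' x - r' \<zeta>) * norm v \<le> \<epsilon> * (norm e + 1)"
        using \<epsilon>(1) by (intro mult_mono) auto
      then show ?thesis
        using norm_blinfun[of "r' x - r' \<zeta>" v] \<epsilon>(2) by simp
    qed
    ultimately show ?thesis
      using a by simp
  qed
  \<comment> \<open>The vertex is within \<open>\<rho>\<close> of \<zeta> and the segment has length
    at most \<open>\<rho> * (norm e + 1)\<close>, so the whole segment stays within
    \<open>d\<close>.\<close>
  define \<rho> where "\<rho> = d / (norm e + 2)"
  have \<rho>: "0 < \<rho>" "\<rho> + \<rho> * (norm e + 1) = d"
  proof -
    have "0 < norm e + 2"
      by (simp add: add_nonneg_pos)
    then have "0 < \<rho>" "\<rho> * (norm e + 2) = d"
      using \<open>0 < d\<close> by (simp_all add: \<rho>_def)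
    then show "0 < \<rho>" "\<rho> + \<rho> * (norm e + 1) = d"
      by (simp_all add: algebra_simps)
  qed
  show thesis
  proof (rule that[OF \<kappa>(1) \<rho>(1)], rule subsetI)
    fix x t y
    assume x: "x \<in> closure D" "dist x \<zeta> < \<rho>" and t: "0 < t" "t < \<rho>"
      and y: "y \<in> ball (x + t *\<^sub>R e) (\<kappa> * t)"
    define v where "v = (y - x) /\<^sub>R t"
    have yv: "y = x + t *\<^sub>R v"
      using t by (simp add: v_def)
    have v: "norm (v - e) < \<kappa>"
    proof -
      have "t *\<^sub>R (v - e) = y - (x + t *\<^sub>R e)"
        by (simp add: yv algebra_simps)
      then have "t * norm (v - e) = dist (x + t *\<^sub>R e) y"
        using t by (metis dist_commute dist_norm norm_scaleR abs_of_pos)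
      then have "t * norm (v - e) < t * \<kappa>"
        using y by (simp add: mult.commute)
      then show ?thesis
        using t by simp
    qed
    have seg: "dist (x + s *\<^sub>R v) \<zeta> < d" if "0 \<le> s" "s \<le> t" for s
    proof -
      have "norm v \<le> norm e + 1"
        using norm_triangle_sub[of v e] v \<kappa>(2) by simp
      then have "s * norm v \<le> \<rho> * (norm e + 1)"
        using that t by (intro mult_mono) auto
      moreover have "dist (x + s *\<^sub>R v) \<zeta> \<le> dist x \<zeta> + s * norm v"
        using dist_triangle[of "x + s *\<^sub>R v" \<zeta> x] that by (simp add: dist_norm)
      ultimately show ?thesis
        using x(2) \<rho>(2) by simp
    qed
    have segU: "x + s *\<^sub>R v \<in> U" if "0 \<le> s" "s \<le> t" for s
      using seg[OF that] d2(2) by (auto simp: d_def dist_commute)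
    have "r (x + t *\<^sub>R v) < r (x + 0 *\<^sub>R v)"
    proof (rule DERIV_neg_imp_decreasing[OF t(1)])
      fix s assume s: "0 \<le> s" "s \<le> t"
      have "((\<lambda>s. x + s *\<^sub>R v) has_derivative (\<lambda>h. h *\<^sub>R v)) (at s)"
        by (auto intro!: derivative_eq_intros)
      from has_derivative_compose[OF this r'[OF segU[OF s]]]
      have "((\<lambda>s. r (x + s *\<^sub>R v)) has_real_derivative r' (x + s *\<^sub>R v) v) (at s)"
        unfolding has_real_derivative_iff_has_vector_derivative has_vector_derivative_def
        by (simp add: blinfun.scaleR_right)
      then show "\<exists>y. ((\<lambda>s. r (x + s *\<^sub>R v)) has_real_derivative y) (at s) \<and> y < 0"
        using neg[OF seg[OF s] v] by blast
    qed
    moreover have "r x \<le> 0"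
      using local_defining_function_nonpos[OF ldf x(1)] segU[of 0] t by simp
    ultimately have "y \<in> {z\<in>U. r z < 0}"
      using segU[of t] t by (simp add: yv)
    then show "y \<in> D"
      using U(3) by blast
  qed
qed

section \<open>Derivative bounds for maps, and boundary values of proper maps\<close>

text \<open>Diagonal products control each entry of the complex Jacobian. Complex linearity carries
  this over to an arbitrary direction \<open>e\<close>, in particular to a cone axis, which need not
  be a coordinate vector.\<close>

lemma holomorphic_derivative_bound:
  fixes F :: "complex ^ 'm \<Rightarrow> complex ^ 'n"
  assumes "open D" "real CARD('m) < p"
    and F': "\<And>z. z \<in> D \<Longrightarrow> (F has_derivative F' z) (at z)"
      "\<And>z c v. z \<in> D \<Longrightarrow> F' z (c *s v) = c *s F' z v"
    and Lp: "\<And>j \<mu>. in_Lp p D (\<lambda>z. dz j (\<lambda>w. F w $ \<mu>) z * cnj (dz j (\<lambda>w. F w $ \<mu>) z))"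
  obtains C where "\<And>z \<delta>. 0 < \<delta> \<Longrightarrow> ball z \<delta> \<subseteq> D \<Longrightarrow> norm (F' z e) \<le> C * \<delta> powr - (real CARD('m) / p)"
proof -
  have loc: "complex_differentiable_on D (\<lambda>z. F z $ \<mu>) (\<lambda>z v. F' z v $ \<mu>)" for \<mu>
    using assms(1) F' by unfold_locales (auto intro: bounded_linear.has_derivative[OF bounded_linear_vec_nth])
  have "\<exists>C\<ge>0. \<forall>z \<delta>. 0 < \<delta> \<longrightarrow> ball z \<delta> \<subseteq> D \<longrightarrow>
    cmod (F' z (axis j 1) $ \<mu>) \<le> C * \<delta> powr - (real CARD('m) / p)" for j \<mu>
    using complex_differentiable_on.deriv_bound_of_in_Lp[OF loc assms(2) Lp] by metis
  then obtain C where C: "\<And>j \<mu> z \<delta>. 0 < \<delta> \<Longrightarrow> ball z \<delta> \<subseteq> D \<Longrightarrow>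
      cmod (F' z (axis j 1) $ \<mu>) \<le> C j \<mu> * \<delta> powr - (real CARD('m) / p)"
    by metis
  show thesis
  proof (rule that)
    fix z \<delta> assume \<delta>: "0 < \<delta>" "ball z \<delta> \<subseteq> D"
    then have z: "z \<in> D"
      by auto
    have "F' z e = F' z (\<Sum>j\<in>UNIV. e $ j *s axis j 1)"
      by (simp add: basis_expansion)
    also have "\<dots> = (\<Sum>j\<in>UNIV. e $ j *s F' z (axis j 1))"
      using F'(2)[OF z] by (simp add: linear_sum[OF has_derivative_linear[OF F'(1)[OF z]]])
    finally have "norm (F' z e) \<le> (\<Sum>j\<in>UNIV. norm (e $ j *s F' z (axis j 1)))"
      by (simp add: norm_sum)
    also have "\<dots> \<le> (\<Sum>j\<in>UNIV. cmod (e $ j) * (\<Sum>\<mu>\<in>UNIV. C j \<mu> * \<delta> powr - (real CARD('m) / p)))"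
    proof (rule sum_mono)
      fix j
      have "norm (F' z (axis j 1)) \<le> (\<Sum>\<mu>\<in>UNIV. cmod (F' z (axis j 1) $ \<mu>))"
        unfolding norm_vec_def by (rule L2_set_le_sum) simp
      also have "\<dots> \<le> (\<Sum>\<mu>\<in>UNIV. C j \<mu> * \<delta> powr - (real CARD('m) / p))"
        by (intro sum_mono C \<delta>)
      finally show "norm (e $ j *s F' z (axis j 1))
          \<le> cmod (e $ j) * (\<Sum>\<mu>\<in>UNIV. C j \<mu> * \<delta> powr - (real CARD('m) / p))"
        by (simp add: norm_vector_smult_complex mult_left_mono)
    qed
    finally show "norm (F' z e) \<le> (\<Sum>j\<in>UNIV. cmod (e $ j) * (\<Sum>\<mu>\<in>UNIV. C j \<mu>)) * \<delta> powr - (real CARD('m) / p)"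
      by (simp add: sum_distrib_right mult.assoc)
  qed
qed

text \<open>If \<open>l\<close> were in \<open>\<Omega>\<close>, the preimage of a small closed ball
  about it would be compact, hence closed in the whole space and not just in \<open>D\<close>. It
  contains all points of \<open>D\<close> near \<open>\<zeta>\<close>, so it would contain
  \<open>\<zeta>\<close>, which is not in \<open>D\<close>.\<close>

lemma proper_map_boundary_limit:
  fixes F :: "'a::metric_space \<Rightarrow> 'b::heine_borel"
  assumes "open D" "open \<Omega>" and proper: "proper_map (top_of_set D) (top_of_set \<Omega>) F"
    and "\<zeta> \<in> frontier D" "(F \<longlongrightarrow> l) (at \<zeta> within D)"
  shows "l \<in> frontier \<Omega>"
proof -
  have FD: "F ` D \<subseteq> \<Omega>"
    using proper_map_imp_subset_topspace[OF proper] by (simp add: image_subset_iff_funcset)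
  have \<zeta>: "\<zeta> \<in> closure D" "\<zeta> \<notin> D"
    using assms(1,4) by (auto simp: frontier_def interior_open)
  then have "at \<zeta> within D \<noteq> bot"
    by (simp add: at_within_eq_bot_iff)
  have ev: "\<forall>\<^sub>F x in at \<zeta> within D. x \<in> D"
    by (simp add: eventually_at_filter)
  then have "\<forall>\<^sub>F x in at \<zeta> within D. F x \<in> closure \<Omega>"
    by eventually_elim (use FD closure_subset in blast)
  then have "l \<in> closure \<Omega>"
    using Lim_in_closed_set[OF closed_closure _ \<open>at \<zeta> within D \<noteq> bot\<close> assms(5)] by simp
  moreover have "l \<notin> \<Omega>"
  proof
    assume "l \<in> \<Omega>"
    then obtain s where s: "0 < s" "cball l s \<subseteq> \<Omega>"
      using assms(2) open_contains_cball by blast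
    have "compactin (top_of_set D) {x \<in> topspace (top_of_set D). F x \<in> cball l s}"
      using s(2) by (intro compactin_proper_map_preimage[OF proper]) (simp add: compactin_subtopology)
    then have "compact {x \<in> D. F x \<in> cball l s}"
      by (simp add: compactin_subtopology)
    then have "closed {x \<in> D. F x \<in> cball l s}"
      by (rule compact_imp_closed)
    moreover have "\<forall>\<^sub>F x in at \<zeta> within D. x \<in> {x \<in> D. F x \<in> cball l s}"
      using ev tendstoD[OF assms(5) s(1)]
      by eventually_elim (simp add: dist_commute less_imp_le)
    ultimately have "\<zeta> \<in> {x \<in> D. F x \<in> cball l s}"
      using Lim_in_closed_set[OF _ _ \<open>at \<zeta> within D \<noteq> bot\<close> tendsto_ident_at] by blast
    then show False
      using \<zeta>(2) by simp
  qed
  ultimately show ?thesis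
    using assms(2) by (simp add: frontier_def interior_open)
qed

theorem theorem1p5:
  fixes D :: "(complex ^ 'm) set"
    and \<Omega> :: "(complex ^ 'n) set"
    and F :: "complex ^ 'm \<Rightarrow> complex ^ 'n"
  assumes "CARD('m) < CARD('n)"
    and "D \<subset> UNIV" and "bounded_strongly_pseudoconvex_domain D"
    and "\<Omega> \<subset> UNIV" and "bounded_strongly_pseudoconvex_domain \<Omega>"
    and "holomorphic_map_on F D"
    and "proper_map (top_of_set D) (top_of_set \<Omega>) F"
    and "\<exists>p::real. p > real CARD('m) \<and>
           (\<forall>(j::'m) (k::'m) (\<mu>::'n) (\<nu>::'n).
              in_Lp p D (\<lambda>z. dz j (\<lambda>w. F w $ \<mu>) z * cnj (dz k (\<lambda>w. F w $ \<nu>) z)))"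
  shows "\<exists>Ft :: complex ^ 'm \<Rightarrow> complex ^ 'n.
           continuous_on (closure D) Ft \<and>
           (\<forall>z\<in>D. Ft z = F z) \<and>
           Ft ` closure D \<subseteq> closure \<Omega> \<and>
           Ft ` frontier D \<subseteq> frontier \<Omega>"
proof -
  obtain p where p: "real CARD('m) < p"
    and Lp: "\<And>j k \<mu> \<nu>. in_Lp p D (\<lambda>z. dz j (\<lambda>w. F w $ \<mu>) z * cnj (dz k (\<lambda>w. F w $ \<nu>) z))"
    using assms(8) by blast
  have open': "open D" "open \<Omega>" and pc: "strongly_pseudoconvex D"
    using assms(3,5) by (simp_all add: bounded_strongly_pseudoconvex_domain_def domain_def)
  obtain F' where F': "\<And>z. z \<in> D \<Longrightarrow> (F has_derivative F' z) (at z)"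
      "\<And>z c v. z \<in> D \<Longrightarrow> F' z (c *s v) = c *s F' z v"
    using assms(6) unfolding holomorphic_map_on_def by metis
  have cont: "continuous_on D F"
    using F'(1) has_derivative_continuous by (intro continuous_at_imp_continuous_on) blast
  have "\<exists>l. (F \<longlongrightarrow> l) (at z within D)" if z: "z \<in> closure D" for z
  proof (cases "z \<in> D")
    case True
    then show ?thesis
      using cont by (auto simp: continuous_on_def)
  next
    case False
    then have "z \<in> frontier D"
      using z open'(1) by (simp add: frontier_def interior_open)
    then obtain U r where "local_defining_function D z U r"
      using pc unfolding strongly_pseudoconvex_def by blast
    then obtain e \<kappa> \<rho> where cone: "0 < \<kappa>" "0 < \<rho>"
      "\<And>x t. x \<in> closure D \<Longrightarrow> dist x z < \<rho> \<Longrightarrow> 0 < t \<Longrightarrow> t < \<rho> \<Longrightarrow> ball (x + t *\<^sub>R e) (\<kappa> * t) \<subseteq> D"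
      by (rule interior_cone_at_boundary) blast
    obtain C where C: "\<And>z \<delta>. 0 < \<delta> \<Longrightarrow> ball z \<delta> \<subseteq> D \<Longrightarrow> norm (F' z e) \<le> C * \<delta> powr - (real CARD('m) / p)"
      using holomorphic_derivative_bound[OF open'(1) p F' Lp] by blast
    have "real CARD('m) / p < 1"
      using p by (simp add: divide_less_eq)
    then show ?thesis
      using tendsto_within_if_derivative_bound[OF z cone(2,1) _ cone(3) F'(1) C] by blast
  qed
  then obtain Ft where Ft: "continuous_on (closure D) Ft" "\<And>z. z \<in> D \<Longrightarrow> Ft z = F z"
    "\<And>z. z \<in> closure D \<Longrightarrow> (F \<longlongrightarrow> Ft z) (at z within D)"
    using continuous_extension_to_closure[OF cont] by blast
  have frontier: "Ft ` frontier D \<subseteq> frontier \<Omega>"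
    using Ft(3) proper_map_boundary_limit[OF open' assms(7)] by (auto simp: frontier_def)
  have "Ft ` D \<subseteq> \<Omega>"
    using Ft(2) proper_map_imp_subset_topspace[OF assms(7)] by (auto simp: Pi_iff)
  then have "Ft ` (D \<union> frontier D) \<subseteq> \<Omega> \<union> frontier \<Omega>"
    using frontier by blast
  then have "Ft ` closure D \<subseteq> closure \<Omega>"
    by (simp only: closure_Un_frontier)
  then show ?thesis
    using Ft(1,2) frontier by blast
qed

end
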